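(* Let $E$ be a finite set and $f\colon 2^E\to\mathbb{R}_+$ a submodular, monotone, normalized function, let $X = B(f)$, and let $\mathcal{C}$ be the set of convex functions $c\colon X\to\mathbb{R}$. Let $\{E_1,\dots,E_k\}$ be the partition of $E$ into the connected components of the polymatroid $(E,f)$. Then for $S\subseteq E$ the following are equivalent: (i) $S$ is controlling for $(X,\mathcal{C})$; (ii) $S$ is identifying for $X$; (iii) $|S\cap E_i| \ge |E_i|-1$ for all $i\in\{1,\dots,k\}$.
   Context: $f$ is submodular if $f(S\cap T)+f(S\cup T)\le f(S)+f(T)$ for all $S,T\subseteq E$, monotone if $f(S)\le f(T)$ for $S\subseteq T$, normalized if $f(\emptyset)=0$. The base polyhedron is $B(f)=\{x\in\mathbb{R}_+^E : x(T)\le f(T)\ \forall T\subseteq E,\ x(E)=f(E)\}$, where $x(T)=\sum_{e\in T}x_e$. A polymatroid $(U,f)$ is connected if there is no non-empty proper subset $T\subsetneq U$ with $f(T)+f(U\setminus T)=f(U)$. The connected components are the unique partition $\{E_1,\dots,E_k\}$ of $E$ such that each $(E_i,f)$ (with $f$ restricted to subsets of $E_i$) is connected and $f(T)=\sum_{i}f(E_i\cap T)$ for all $T\subseteq E$. A set $S \subseteq E$ is controlling for $(X,\mathcal{C})$ if for every $c \in \mathcal{C}$ and every $x^* \in X$ there is $\gamma \in \mathbb{R}^S$ such that $\min_{x \in X}\{c(x) + \sum_{e\in S}\gamma_e x_e\}$ exists and is attained at $x^*$. A set $S$ is identifying for $X$ if for all $x\ne x'$ in $X$ there is $e\in S$ with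 $x_e\ne x'_e$.
   Formalization: The set of costs is restricted to convex functions on X that extend to a finite convex function on an open neighbourhood of X; for all convex c on X the claim fails, e.g. c(x) = -sqrt(x_1) on {x >= 0, x_1 + x_2 = 1} at x* = (0,1) with S = E. *)

theory Defs
  imports "HOL-Analysis.Analysis"
begin

definition submodular_on :: "'e set \<Rightarrow> ('e set \<Rightarrow> real) \<Rightarrow> bool" where
  "submodular_on E f \<longleftrightarrow>
     (\<forall>S T. S \<subseteq> E \<longrightarrow> T \<subseteq> E \<longrightarrow> f (S \<inter> T) + f (S \<union> T) \<le> f S + f T)"

definition polymatroid :: "'e set \<Rightarrow> ('e set \<Rightarrow> real) \<Rightarrow> bool" where
  "polymatroid E f \<longleftrightarrow>
     (\<forall>T\<subseteq>E. 0 \<le> f T) \<and> submodular_on E f \<and> mono_on (Pow E) f \<and> f {} = 0"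

text \<open>
  The ground set \<open>E\<close> is an arbitrary (possibly empty) subset of a finite index type, and
  \<open>\<real>\<^sup>E\<close> is the coordinate subspace of the vectors that vanish outside \<open>E\<close>.
\<close>

definition base_polyhedron :: "'e set \<Rightarrow> ('e set \<Rightarrow> real) \<Rightarrow> (real ^ 'e::finite) set" where
  "base_polyhedron E f =
     {x. (\<forall>e. e \<notin> E \<longrightarrow> x $ e = 0) \<and> (\<forall>e\<in>E. 0 \<le> x $ e) \<and>
         (\<forall>T\<subseteq>E. (\<Sum>e\<in>T. x $ e) \<le> f T) \<and> (\<Sum>e\<in>E. x $ e) = f E}"

definition polymatroid_connected :: "'e set \<Rightarrow> ('e set \<Rightarrow> real) \<Rightarrow> bool" where
  "polymatroid_connected U f \<longleftrightarrow> \<not> (\<exists>T. T \<noteq> {} \<and> T \<subset> U \<and> f T + f (U - T) = f U)"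

definition polymatroid_components ::
    "'e set \<Rightarrow> ('e set \<Rightarrow> real) \<Rightarrow> 'e set set \<Rightarrow> bool" where
  "polymatroid_components E f P \<longleftrightarrow>
     partition_on E P \<and> (\<forall>U\<in>P. polymatroid_connected U f) \<and>
     (\<forall>T\<subseteq>E. f T = (\<Sum>U\<in>P. f (U \<inter> T)))"

text \<open>
  The convex functions \<open>X \<rightarrow> \<real>\<close>, with the convention that they are finite and convex on
  an open neighbourhood of \<open>X\<close>, which guarantees subgradients at the boundary points of \<open>X\<close>.
  Without it no set is controlling as soon as \<open>X\<close> has two points: for
  \<open>X = {x \<ge> 0. x\<^sub>1 + x\<^sub>2 = 1}\<close> the function \<open>- sqrt x\<^sub>1\<close> is continuous and convex on \<open>X\<close>, but
  no linear perturbation of it has a minimum at \<open>(0, 1)\<close>.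
  Only the values of \<open>c\<close> on \<open>X\<close> matter.
\<close>

definition convex_costs :: "'v::real_normed_vector set \<Rightarrow> ('v \<Rightarrow> real) set" where
  "convex_costs X =
     {c. convex_on X c \<and>
         (\<exists>U g. open U \<and> X \<subseteq> U \<and> convex_on U g \<and> (\<forall>x\<in>X. g x = c x))}"

definition controlling ::
    "'e set \<Rightarrow> (real ^ 'e::finite) set \<Rightarrow> (real ^ 'e \<Rightarrow> real) set \<Rightarrow> bool" where
  "controlling S X C \<longleftrightarrow>
     (\<forall>c\<in>C. \<forall>z\<in>X. \<exists>\<gamma> :: 'e \<Rightarrow> real.
        is_arg_min (\<lambda>x. c x + (\<Sum>e\<in>S. \<gamma> e * x $ e)) (\<lambda>x. x \<in> X) z)"

definition identifying :: "'e set \<Rightarrow> (real ^ 'e::finite) set \<Rightarrow> bool" where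
  "identifying S X \<longleftrightarrow> (\<forall>x\<in>X. \<forall>y\<in>X. x \<noteq> y \<longrightarrow> (\<exists>e\<in>S. x $ e \<noteq> y $ e))"

end

theory Submission
  imports Defs
begin

text \<open>
  On \<open>B(f)\<close> the coordinate sum over each component \<open>U\<close> is the constant \<open>f U\<close>. Hence if \<open>S\<close> misses
  at most one element \<open>w\<close> of each component, the terms of a subgradient \<open>h\<close> of the cost at the
  prescribed point can be cancelled by \<open>\<gamma> e = h w - h e\<close>, so \<open>S\<close> is controlling. The linear cost
  \<open>v \<mapsto> (y - x) \<bullet> v\<close> shows that a controlling set distinguishes any two bases \<open>x\<close>, \<open>y\<close>.
  Finally, suppose \<open>S\<close> misses \<open>e \<noteq> d\<close> in a component. Every set \<open>T\<close> separating them has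
  \<open>f T + f (E - T) > f E\<close>, so a greedy base that is tight on \<open>E - T\<close> is not tight on \<open>T\<close>. Averaging
  gives a base for which no set containing \<open>e\<close> but not \<open>d\<close> is tight, and moving a small amount of
  weight from \<open>d\<close> to \<open>e\<close> yields a second base with the same coordinates on \<open>S\<close>.
\<close>

section \<open>Subgradients, and strict inequalities on convex sets\<close>

lemma convex_on_open_subgradient:
  fixes g :: "'a::euclidean_space \<Rightarrow> real"
  assumes "open U" "convex_on U g" "z \<in> U"
  obtains h where "\<And>x. x \<in> U \<Longrightarrow> g z + h \<bullet> (x - z) \<le> g x"
proof -
  \<comment> \<open>The open ray below the graph point \<open>(z, g z)\<close> is convex and misses
    the epigraph. A hyperplane with normal \<open>(p, q)\<close> separates the two, and its slope
    \<open>- (1 / q) *\<^sub>R p\<close> is the subgradient once \<open>q > 0\<close>.\<close>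
  let ?L = "{z} \<times> {..<g z}"
  have "(z, g z - 1) \<in> ?L" "(z, g z) \<in> epigraph U g"
    using assms by (auto simp: mem_epigraph)
  moreover have "?L \<inter> epigraph U g = {}"
    by (auto simp: mem_epigraph)
  moreover have "convex ?L"
    by (intro convex_Times) auto
  ultimately obtain a b where a: "a \<noteq> 0" "\<And>v. v \<in> ?L \<Longrightarrow> a \<bullet> v \<le> b"
      "\<And>v. v \<in> epigraph U g \<Longrightarrow> b \<le> a \<bullet> v"
    using separating_hyperplane_sets[of ?L "epigraph U g"] convex_epigraphI[OF assms(2)]
    by (metis empty_iff)
  obtain p q where pq: "a = (p, q)" by force
  have sep: "p \<bullet> z + q * s \<le> p \<bullet> x + q * t" if "s < g z" "x \<in> U" "g x \<le> t" for s x t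
    using a(2)[of "(z, s)"] a(3)[of "(x, t)"] that by (auto simp: pq mem_epigraph)
  have "q \<ge> 0"
    using sep[of "g z - 1" z "g z"] assms(3) by (simp add: algebra_simps)
  \<comment> \<open>The hyperplane cannot be vertical: since \<open>U\<close> is open, it contains a
    point reached from \<open>z\<close> by a step against \<open>p\<close>, where \<open>p\<close>
    has a smaller inner product than at \<open>z\<close>.\<close>
  moreover have "q \<noteq> 0"
  proof
    assume "q = 0"
    then have "p \<noteq> 0" using a(1) pq by (auto simp: zero_prod_def)
    obtain r where r: "r > 0" "cball z r \<subseteq> U"
      using assms(1,3) open_contains_cball by blast
    have "z - (r / norm p) *\<^sub>R p \<in> U"
      using r \<open>p \<noteq> 0\<close> by (intro subsetD[OF r(2)]) (auto simp: dist_norm)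
    then have "p \<bullet> z \<le> p \<bullet> (z - (r / norm p) *\<^sub>R p)"
      using sep[of "g z - 1" _ "g (z - (r / norm p) *\<^sub>R p)"] \<open>q = 0\<close> by force
    then have "(r / norm p) * (p \<bullet> p) \<le> 0"
      by (simp add: inner_diff_right)
    moreover have "(r / norm p) * (p \<bullet> p) > 0"
      using r \<open>p \<noteq> 0\<close> by (intro mult_pos_pos) auto
    ultimately show False by simp
  qed
  ultimately have "q > 0" by simp
  have "g z + (- (1 / q) *\<^sub>R p) \<bullet> (x - z) \<le> g x" if "x \<in> U" for x
  \<comment> \<open>\<open>sep\<close> only covers heights strictly below \<open>g z\<close>, hence
    the detour through \<delta>.\<close>
  proof (rule field_le_epsilon)
    fix \<delta> :: real
    assume "\<delta> > 0"
    have "p \<bullet> z + q * (g z - \<delta>) \<le> p \<bullet> x + q * g x"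
      using sep[of "g z - \<delta>" x "g x"] that \<open>\<delta> > 0\<close> by simp
    then show "g z + (- (1 / q) *\<^sub>R p) \<bullet> (x - z) \<le> g x + \<delta>"
      using \<open>q > 0\<close> by (simp add: field_simps inner_diff_right)
  qed
  then show thesis by (rule that)
qed

text \<open>Midpoints keep strictness: there each functional is the mean of two values that are at
  most \<open>b i\<close>, and one strict value suffices. Induction on \<open>I\<close> thus merges
  the separate witnesses into one.\<close>

lemma convex_common_strict:
  fixes g :: "'i \<Rightarrow> 'v::real_vector \<Rightarrow> real"
  assumes "convex X" "X \<noteq> {}" "finite I" "\<And>i. i \<in> I \<Longrightarrow> linear (g i)"
    and "\<And>i x. i \<in> I \<Longrightarrow> x \<in> X \<Longrightarrow> g i x \<le> b i"
    and "\<And>i. i \<in> I \<Longrightarrow> \<exists>x\<in>X. g i x < b i"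
  shows "\<exists>x\<in>X. \<forall>i\<in>I. g i x < b i"
  using assms(3-6)
proof (induction I rule: finite_induct)
  case empty
  then show ?case using assms(2) by auto
next
  case (insert j I)
  obtain x where x: "x \<in> X" "\<forall>i\<in>I. g i x < b i"
    using insert by (metis insertI2)
  obtain y where y: "y \<in> X" "g j y < b j"
    using insert.prems(3) by blast
  let ?m = "(1/2) *\<^sub>R x + (1/2) *\<^sub>R y"
  have "?m \<in> X"
    using assms(1) x y by (intro convexD) auto
  moreover have "g i ?m < b i" if "i \<in> insert j I" for i
  proof -
    have "g i ?m = (g i x + g i y) / 2"
      using insert.prems(1)[OF that] by (simp add: linear_add linear_scale field_simps)
    moreover have "g i x + g i y < 2 * b i"
      using insert.prems(2)[OF that x(1)] insert.prems(2)[OF that y(1)] x(2) y(2) that by force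
    ultimately show ?thesis by simp
  qed
  ultimately show ?case by blast
qed

section \<open>The base polyhedron and greedy bases\<close>

lemma convex_base_polyhedron: "convex (base_polyhedron E f)"
proof (rule convexI)
  fix x y :: "real ^ 'a" and u v :: real
  assume x: "x \<in> base_polyhedron E f" and y: "y \<in> base_polyhedron E f"
    and uv: "0 \<le> u" "0 \<le> v" "u + v = 1"
  have sum: "(\<Sum>e\<in>T. (u *\<^sub>R x + v *\<^sub>R y) $ e) = u * (\<Sum>e\<in>T. x $ e) + v * (\<Sum>e\<in>T. y $ e)" for T
    by (simp add: sum.distrib sum_distrib_left)
  have "u * (\<Sum>e\<in>T. x $ e) + v * (\<Sum>e\<in>T. y $ e) \<le> f T" if "T \<subseteq> E" for T
    using x y uv that by (intro convex_bound_le) (auto simp: base_polyhedron_def)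
  then show "u *\<^sub>R x + v *\<^sub>R y \<in> base_polyhedron E f"
    unfolding base_polyhedron_def mem_Collect_eq sum
    using x y uv by (auto simp: base_polyhedron_def simp flip: distrib_right)
qed

lemma polymatroid_subset: "polymatroid E f \<Longrightarrow> A \<subseteq> E \<Longrightarrow> polymatroid A f"
  unfolding polymatroid_def submodular_on_def by (auto intro: mono_on_subset)

lemma polymatroid_mono: "polymatroid E f \<Longrightarrow> A \<subseteq> B \<Longrightarrow> B \<subseteq> E \<Longrightarrow> f A \<le> f B"
  unfolding polymatroid_def by (auto intro: mono_onD)

lemma polymatroid_submodular:
  "polymatroid E f \<Longrightarrow> A \<subseteq> E \<Longrightarrow> B \<subseteq> E \<Longrightarrow> f (A \<inter> B) + f (A \<union> B) \<le> f A + f B"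
  unfolding polymatroid_def submodular_on_def by blast

text \<open>Nonnegativity comes for free: \<open>x e = f E - x (E - {e}) \<ge> f E - f (E - {e}) \<ge> 0\<close>.\<close>

lemma base_polyhedronI:
  assumes "polymatroid E f" "\<And>e. e \<notin> E \<Longrightarrow> x $ e = 0"
    and "\<And>T. T \<subseteq> E \<Longrightarrow> (\<Sum>e\<in>T. x $ e) \<le> f T" "(\<Sum>e\<in>E. x $ e) = f E"
  shows "x \<in> base_polyhedron E f"
proof -
  have "0 \<le> x $ e" if "e \<in> E" for e
  proof -
    have "(\<Sum>e\<in>E. x $ e) = x $ e + (\<Sum>e\<in>E - {e}. x $ e)"
      using that by (simp add: sum.remove)
    moreover have "(\<Sum>e\<in>E - {e}. x $ e) \<le> f (E - {e})" "f (E - {e}) \<le> f E"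
      using assms(3) polymatroid_mono[OF assms(1)] by auto
    ultimately show ?thesis using assms(4) by simp
  qed
  then show ?thesis using assms by (simp add: base_polyhedron_def)
qed

text \<open>One greedy step: the new coordinate is the marginal value of \<open>a\<close> over
  \<open>A\<close>. By submodularity it is at most the marginal value of \<open>a\<close> over
  \<open>T - {a}\<close>, for every \<open>T\<close> containing \<open>a\<close>.\<close>

lemma base_polyhedron_insert:
  assumes "polymatroid (insert a A) f" "a \<notin> A" "x \<in> base_polyhedron A f"
  shows "x + axis a (f (insert a A) - f A) \<in> base_polyhedron (insert a A) f" (is "?y \<in> _")
proof (rule base_polyhedronI[OF assms(1)])
  have x: "\<And>e. e \<notin> A \<Longrightarrow> x $ e = 0" "\<And>T. T \<subseteq> A \<Longrightarrow> (\<Sum>e\<in>T. x $ e) \<le> f T"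
      "(\<Sum>e\<in>A. x $ e) = f A"
    using assms(3) by (auto simp: base_polyhedron_def)
  have ya: "?y $ a = f (insert a A) - f A" and ye: "e \<noteq> a \<Longrightarrow> ?y $ e = x $ e" for e
    using x(1) assms(2) by (auto simp: axis_def)
  have sum_y: "(\<Sum>e\<in>T. ?y $ e) = (\<Sum>e\<in>T. x $ e)" if "a \<notin> T" for T
    using that ye by (metis (no_types, lifting) sum.cong)
  show "?y $ e = 0" if "e \<notin> insert a A" for e
    using that x(1) ye by auto
  show "(\<Sum>e\<in>insert a A. ?y $ e) = f (insert a A)"
    using assms(2) x(3) ya sum_y[of A] by (subst sum.insert) auto
  show "(\<Sum>e\<in>T. ?y $ e) \<le> f T" if T: "T \<subseteq> insert a A" for T
  proof (cases "a \<in> T")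
    case False
    then show ?thesis using T x(2)[of T] sum_y by (simp add: subset_insert)
  next
    case True
    then have "T \<inter> A = T - {a}" "T \<union> A = insert a A"
      using T assms(2) by auto
    then have "f (T - {a}) + f (insert a A) \<le> f T + f A"
      using polymatroid_submodular[OF assms(1) T, of A] by auto
    moreover have "(\<Sum>e\<in>T. ?y $ e) = ?y $ a + (\<Sum>e\<in>T - {a}. x $ e)"
      using True sum_y[of "T - {a}"] by (subst sum.remove[of _ a]) auto
    moreover have "(\<Sum>e\<in>T - {a}. x $ e) \<le> f (T - {a})"
      using T by (intro x(2)) auto
    ultimately show ?thesis using ya by simp
  qed
qed

lemma base_polyhedron_extend:
  fixes x :: "real ^ 'e::finite"
  assumes "polymatroid (A \<union> D) f" "A \<inter> D = {}" "x \<in> base_polyhedron A f"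
  shows "\<exists>y\<in>base_polyhedron (A \<union> D) f. \<forall>e\<in>A. y $ e = x $ e"
  using finite[of D] assms
proof (induction D rule: finite_induct)
  case empty
  then show ?case by auto
next
  case (insert d D)
  have "polymatroid (A \<union> D) f"
    using insert.prems(1) by (rule polymatroid_subset) auto
  then obtain y where y: "y \<in> base_polyhedron (A \<union> D) f" "\<forall>e\<in>A. y $ e = x $ e"
    using insert by auto
  have "y + axis d (f (insert d (A \<union> D)) - f (A \<union> D)) \<in> base_polyhedron (insert d (A \<union> D)) f"
    using insert.prems insert.hyps y(1) by (intro base_polyhedron_insert) auto
  moreover have "(y + axis d c) $ e = x $ e" if "e \<in> A" for e c
    using that insert.prems(2) y(2) by (auto simp: axis_def)
  ultimately show ?case by (metis Un_insert_right)
qed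

text \<open>The greedy procedure runs through \<open>A\<close> first. It ends that stage with a base
  of \<open>A\<close>, and processing \<open>E - A\<close> leaves these coordinates fixed.\<close>

lemma base_polyhedron_tight_on:
  fixes E A :: "'e::finite set"
  assumes "polymatroid E f" "A \<subseteq> E"
  shows "\<exists>y\<in>base_polyhedron E f. (\<Sum>e\<in>A. y $ e) = f A"
proof -
  have "f {} = 0" using assms(1) by (simp add: polymatroid_def)
  then have "0 \<in> base_polyhedron {} f"
    by (auto simp: base_polyhedron_def)
  then obtain x where x: "x \<in> base_polyhedron A f"
    using base_polyhedron_extend[of "{}" A f 0] polymatroid_subset[OF assms] by auto
  have "A \<union> (E - A) = E" using assms(2) by auto
  then obtain y where "y \<in> base_polyhedron E f" "\<forall>e\<in>A. y $ e = x $ e"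
    using base_polyhedron_extend[OF _ _ x, of "E - A"] assms(1) by auto
  moreover have "(\<Sum>e\<in>A. x $ e) = f A"
    using x by (simp add: base_polyhedron_def)
  ultimately show ?thesis by (metis (no_types, lifting) sum.cong)
qed

section \<open>Exchanging weight inside a component\<close>

lemma component_separation_strict:
  fixes E T :: "'e::finite set"
  assumes "polymatroid E f" "polymatroid_components E f P" "U \<in> P" "T \<subseteq> E"
    and "e \<in> U \<inter> T" "d \<in> U - T"
  shows "f E < f T + f (E - T)"
proof -
  have part: "partition_on E P" and conn: "polymatroid_connected U f"
    and split: "\<And>T. T \<subseteq> E \<Longrightarrow> f T = (\<Sum>W\<in>P. f (W \<inter> T))"
    using assms(2,3) by (auto simp: polymatroid_components_def)
  \<comment> \<open>Subadditivity holds in each component. In \<open>U\<close> it is strict by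
    connectedness, because \<open>e\<close> and \<open>d\<close> make \<open>U \<inter> T\<close>
    nonempty and proper, and the strictness survives summation over \<open>P\<close>.\<close>
  have le: "f W \<le> f (W \<inter> T) + f (W \<inter> (E - T))" if "W \<in> P" for W
  proof -
    have "W \<subseteq> E" using partition_onD1[OF part] that by auto
    then have "(W \<inter> T) \<union> (W \<inter> (E - T)) = W" "(W \<inter> T) \<inter> (W \<inter> (E - T)) = {}" by auto
    moreover have "f {} = 0" using assms(1) by (simp add: polymatroid_def)
    ultimately show ?thesis
      using polymatroid_submodular[OF assms(1), of "W \<inter> T" "W \<inter> (E - T)"] \<open>W \<subseteq> E\<close> by auto
  qed
  have "U \<subseteq> E" using partition_onD1[OF part] assms(3) by auto
  then have "U \<inter> (E - T) = U - (U \<inter> T)" by auto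
  moreover have "U \<inter> T \<noteq> {}" "U \<inter> T \<subset> U" using assms by auto
  ultimately have "f (U \<inter> T) + f (U \<inter> (E - T)) \<noteq> f U"
    using conn by (auto simp: polymatroid_connected_def)
  then have "f U < f (U \<inter> T) + f (U \<inter> (E - T))"
    using le[OF assms(3)] by simp
  moreover have "W \<inter> E = W" if "W \<in> P" for W
    using partition_onD1[OF part] that by auto
  ultimately have "(\<Sum>W\<in>P. f (W \<inter> E)) < (\<Sum>W\<in>P. f (W \<inter> T) + f (W \<inter> (E - T)))"
    using le assms(3) by (intro sum_strict_mono_ex1) auto
  then show ?thesis
    using split[of E] split[of T] split[of "E - T"] assms(4) by (simp add: sum.distrib)
qed

lemma component_exchange:
  fixes E :: "'e::finite set"
  assumes "polymatroid E f" "polymatroid_components E f P" "U \<in> P"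
    and "e \<in> U" "d \<in> U" "e \<noteq> d"
  shows "\<exists>x\<in>base_polyhedron E f. \<exists>\<epsilon>>0. x + axis e \<epsilon> - axis d \<epsilon> \<in> base_polyhedron E f"
proof -
  let ?X = "base_polyhedron E f"
  let ?F = "{T. T \<subseteq> E \<and> e \<in> T \<and> d \<notin> T}"
  have "U \<subseteq> E"
    using assms(2,3) by (auto simp: polymatroid_components_def dest: partition_onD1)
  have "\<exists>x\<in>?X. \<forall>T\<in>?F. (\<Sum>a\<in>T. x $ a) < f T"
  proof (rule convex_common_strict)
    show "?X \<noteq> {}" using base_polyhedron_tight_on[OF assms(1), of "{}"] by auto
    show "linear (\<lambda>x :: real ^ 'e. \<Sum>a\<in>T. x $ a)" for T
      by (rule linearI) (simp_all add: sum.distrib sum_distrib_left)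
    show "(\<Sum>a\<in>T. x $ a) \<le> f T" if "T \<in> ?F" "x \<in> ?X" for T x
      using that by (auto simp: base_polyhedron_def)
    show "\<exists>x\<in>?X. (\<Sum>a\<in>T. x $ a) < f T" if T: "T \<in> ?F" for T
    proof -
      \<comment> \<open>Tightness on the complement leaves exactly \<open>f E - f (E - T)\<close>
        for \<open>T\<close>, which is less than \<open>f T\<close>.\<close>
      obtain x where x: "x \<in> ?X" "(\<Sum>a\<in>E - T. x $ a) = f (E - T)"
        using base_polyhedron_tight_on[OF assms(1), of "E - T"] by auto
      have "(\<Sum>a\<in>E. x $ a) = (\<Sum>a\<in>E - T. x $ a) + (\<Sum>a\<in>T. x $ a)"
        using T by (intro sum.subset_diff) auto
      moreover have "(\<Sum>a\<in>E. x $ a) = f E" using x(1) by (simp add: base_polyhedron_def)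
      moreover have "f E < f T + f (E - T)"
        using T assms by (intro component_separation_strict[of E f P U T e d]) auto
      ultimately show ?thesis using x by (intro bexI[of _ x]) auto
    qed
  qed (auto intro: convex_base_polyhedron)
  then obtain x where x: "x \<in> ?X" "\<And>T. T \<in> ?F \<Longrightarrow> (\<Sum>a\<in>T. x $ a) < f T"
    by blast
  \<comment> \<open>The smallest slack over the finite family \<open>?F\<close>; the inserted 1
    makes nonemptiness of the set immediate.\<close>
  define \<epsilon> where "\<epsilon> = Min (insert 1 ((\<lambda>T. f T - (\<Sum>a\<in>T. x $ a)) ` ?F))"
  have "\<epsilon> > 0"
    unfolding \<epsilon>_def using x(2) by (subst Min_gr_iff) auto
  have slack: "(\<Sum>a\<in>T. x $ a) + \<epsilon> \<le> f T" if "T \<in> ?F" for T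
  proof -
    have "\<epsilon> \<le> f T - (\<Sum>a\<in>T. x $ a)"
      unfolding \<epsilon>_def using that by (intro Min_le) auto
    then show ?thesis by simp
  qed
  let ?y = "x + axis e \<epsilon> - axis d \<epsilon>"
  have sum: "(\<Sum>a\<in>T. ?y $ a) =
      (\<Sum>a\<in>T. x $ a) + (if e \<in> T then \<epsilon> else 0) - (if d \<in> T then \<epsilon> else 0)" for T
    by (simp add: sum.distrib sum_subtractf axis_def)
  have "?y \<in> ?X"
  \<comment> \<open>The lowered coordinate at \<open>d\<close> stays nonnegative by this rule, so
    \<epsilon> need not be compared with \<open>x $ d\<close>. Only sets in \<open>?F\<close> gain
    weight.\<close>
  proof (rule base_polyhedronI[OF assms(1)])
    show "?y $ a = 0" if "a \<notin> E" for a
      using that x(1) assms(4,5) \<open>U \<subseteq> E\<close> by (auto simp: base_polyhedron_def axis_def)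
    show "(\<Sum>a\<in>E. ?y $ a) = f E"
      unfolding sum using x(1) assms(4,5) \<open>U \<subseteq> E\<close> by (auto simp: base_polyhedron_def)
    show "(\<Sum>a\<in>T. ?y $ a) \<le> f T" if "T \<subseteq> E" for T
    proof (cases "e \<in> T \<and> d \<notin> T")
      case True
      then show ?thesis unfolding sum using slack[of T] that by auto
    next
      case False
      moreover have "(\<Sum>a\<in>T. x $ a) \<le> f T"
        using x(1) that by (auto simp: base_polyhedron_def)
      ultimately show ?thesis unfolding sum using \<open>\<epsilon> > 0\<close> by auto
    qed
  qed
  then show ?thesis using x(1) \<open>\<epsilon> > 0\<close> by blast
qed

section \<open>Sums over the components\<close>

lemma sum_components:
  assumes "partition_on E P" "finite E"
  shows "(\<Sum>U\<in>P. \<Sum>e\<in>U. g e) = (\<Sum>e\<in>E. g e)"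
proof -
  have "finite U" if "U \<in> P" for U
    using partition_onD1[OF assms(1)] assms(2) that by (meson Sup_upper finite_subset)
  moreover have "A \<inter> B = {}" if "A \<in> P" "B \<in> P" "A \<noteq> B" for A B
    using partition_onD2[OF assms(1)] that by (auto dest: disjointD)
  ultimately show ?thesis
    using sum.Union_disjoint[of P g] partition_onD1[OF assms(1)] by auto
qed

text \<open>The bounds \<open>f W\<close> add up to \<open>f E\<close>, which is also the total
  weight of \<open>x\<close>, so slack in a single component would make the total too small.\<close>

lemma base_polyhedron_component_sum:
  fixes E :: "'e::finite set"
  assumes "polymatroid_components E f P" "x \<in> base_polyhedron E f" "U \<in> P"
  shows "(\<Sum>e\<in>U. x $ e) = f U"
proof (rule ccontr)
  assume neq: "(\<Sum>e\<in>U. x $ e) \<noteq> f U"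
  have part: "partition_on E P" and fE: "f E = (\<Sum>W\<in>P. f (W \<inter> E))"
    using assms(1) by (auto simp: polymatroid_components_def)
  have sub: "W \<subseteq> E" if "W \<in> P" for W
    using partition_onD1[OF part] that by auto
  have le: "(\<Sum>e\<in>W. x $ e) \<le> f W" if "W \<in> P" for W
    using assms(2) sub[OF that] by (auto simp: base_polyhedron_def)
  then have "(\<Sum>W\<in>P. \<Sum>e\<in>W. x $ e) < (\<Sum>W\<in>P. f W)"
    using assms(3) neq by (intro sum_strict_mono_ex1) (auto simp: order.strict_iff_order)
  also have "\<dots> = f E"
    unfolding fE using sub by (intro sum.cong) (auto simp: Int_absorb2)
  also have "\<dots> = (\<Sum>W\<in>P. \<Sum>e\<in>W. x $ e)"
    using assms(2) by (simp add: sum_components[OF part] base_polyhedron_def)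
  finally show False by simp
qed

section \<open>The implications between the three conditions\<close>

lemma controlling_imp_identifying:
  assumes "convex X" "controlling S X (convex_costs X)"
  shows "identifying S X"
  unfolding identifying_def
proof (intro ballI impI, rule ccontr)
  fix x y
  assume x: "x \<in> X" and y: "y \<in> X" and "x \<noteq> y" and "\<not> (\<exists>e\<in>S. x $ e \<noteq> y $ e)"
  then have eq: "(\<Sum>e\<in>S. \<gamma> e * x $ e) = (\<Sum>e\<in>S. \<gamma> e * y $ e)" for \<gamma>
    by (intro sum.cong) auto
  \<comment> \<open>This cost is larger at \<open>y\<close> than at \<open>x\<close> by the squared
    norm of \<open>y - x\<close>. The \<gamma> terms agree at both points, so no perturbation makes
    \<open>y\<close> a minimizer.\<close>
  let ?c = "\<lambda>v. (y - x) \<bullet> v"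
  have conv: "convex_on A ?c" if "convex A" for A
    using that by (auto simp: convex_on_def inner_add_right)
  have "?c \<in> convex_costs X"
    unfolding convex_costs_def using conv assms(1)
    by (auto intro!: exI[of _ UNIV] exI[of _ ?c])
  then obtain \<gamma> where
    "is_arg_min (\<lambda>v. ?c v + (\<Sum>e\<in>S. \<gamma> e * v $ e)) (\<lambda>v. v \<in> X) y"
    using assms(2) y unfolding controlling_def by blast
  then have "?c y \<le> ?c x"
    using x eq[of \<gamma>] by (auto simp: is_arg_min_linorder)
  then have "(y - x) \<bullet> (y - x) \<le> 0"
    by (simp add: inner_diff_right)
  then show False using \<open>x \<noteq> y\<close> by (metis inner_gt_zero_iff not_le right_minus_eq)
qed

lemma identifying_imp_card:
  fixes E S :: "'e::finite set"
  assumes "polymatroid E f" "polymatroid_components E f P"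
    and "identifying S (base_polyhedron E f)" "U \<in> P"
  shows "card U - 1 \<le> card (S \<inter> U)"
proof (rule ccontr)
  assume less: "\<not> card U - 1 \<le> card (S \<inter> U)"
  have "card U = card (S \<inter> U) + card (U - S)"
    by (metis Int_commute card_Int_Diff finite)
  \<comment> \<open>Failure of the bound, with truncated subtraction, means that at least two
    elements of \<open>U\<close> lie outside \<open>S\<close>.\<close>
  then have "\<not> card (U - S) \<le> Suc 0" using less by linarith
  then obtain e d where ed: "e \<in> U - S" "d \<in> U - S" "e \<noteq> d"
    by (auto simp: card_le_Suc0_iff_eq)
  obtain x \<epsilon> where x: "x \<in> base_polyhedron E f" "\<epsilon> > 0"
      "x + axis e \<epsilon> - axis d \<epsilon> \<in> base_polyhedron E f" (is "?y \<in> _")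
    using component_exchange[OF assms(1,2,4), of e d] ed by auto
  have "?y $ e = x $ e + \<epsilon>" using ed by (simp add: axis_def)
  then have "x \<noteq> ?y" using x(2) by (metis add_cancel_left_right less_irrefl)
  then obtain a where "a \<in> S" "x $ a \<noteq> ?y $ a"
    using assms(3) x unfolding identifying_def by blast
  then show False using ed by (auto simp: axis_def split: if_splits)
qed

lemma card_imp_controlling:
  fixes E S :: "'e::finite set"
  assumes comp: "polymatroid_components E f P" and "S \<subseteq> E"
    and card: "\<And>U. U \<in> P \<Longrightarrow> card U - 1 \<le> card (S \<inter> U)"
  defines "X \<equiv> base_polyhedron E f"
  shows "controlling S X (convex_costs X)"
  unfolding controlling_def
proof (intro ballI)
  fix c z
  assume c: "c \<in> convex_costs X" and z: "z \<in> X"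
  obtain V g where V: "open V" "X \<subseteq> V" "convex_on V g" "\<And>x. x \<in> X \<Longrightarrow> g x = c x"
    using c by (auto simp: convex_costs_def)
  obtain h where h: "\<And>x. x \<in> V \<Longrightarrow> g z + h \<bullet> (x - z) \<le> g x"
    using convex_on_open_subgradient[OF V(1,3)] V(2) z by blast
  have part: "partition_on E P"
    using comp by (simp add: polymatroid_components_def)
  have "\<exists>w. \<forall>e\<in>U - S. e = w" if "U \<in> P" for U
  proof -
    have "card U = card (S \<inter> U) + card (U - S)"
      by (metis Int_commute card_Int_Diff finite)
    then have "card (U - S) \<le> Suc 0" using card[OF that] by linarith
    then show ?thesis by (metis card_le_Suc0_iff_eq finite)
  qed
  \<comment> \<open>\<open>w U\<close> is the one element of \<open>U\<close> missed by
    \<open>S\<close>; if there is none, \<open>w U\<close> is arbitrary.\<close>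
  then obtain w where w: "\<And>U e. U \<in> P \<Longrightarrow> e \<in> U - S \<Longrightarrow> e = w U" by metis
  have "\<exists>U. U \<in> P \<and> e \<in> U" if "e \<in> E" for e
    using partition_onD1[OF part] that by auto
  then obtain C where C: "\<And>e. e \<in> E \<Longrightarrow> C e \<in> P \<and> e \<in> C e" by metis
  have C_eq: "C e = U" if "U \<in> P" "e \<in> U" for e U
  proof -
    have "e \<in> E" using partition_onD1[OF part] that by auto
    then show ?thesis using C[of e] that partition_onD2[OF part] by (auto dest: disjointD)
  qed
  \<comment> \<open>Adding \<gamma> to \<open>h\<close> makes the coefficients constant on each
    component, where \<open>x - z\<close> has sum zero. As \<gamma> vanishes on
    \<open>E - S\<close>, the perturbation uses coordinates in \<open>S\<close> only.\<close>
  define \<gamma> where "\<gamma> e = h $ w (C e) - h $ e" for e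
  have key: "h \<bullet> (x - z) + (\<Sum>e\<in>S. \<gamma> e * (x - z) $ e) = 0" if x: "x \<in> X" for x
  proof -
    have out: "(x - z) $ e = 0" if "e \<notin> E" for e
      using x z that by (simp add: X_def base_polyhedron_def)
    have "h \<bullet> (x - z) = (\<Sum>e\<in>E. h $ e * (x - z) $ e)"
      unfolding inner_vec_def inner_real_def using out by (intro sum.mono_neutral_right) auto
    moreover have "(\<Sum>e\<in>S. \<gamma> e * (x - z) $ e) = (\<Sum>e\<in>E. \<gamma> e * (x - z) $ e)"
    proof (rule sum.mono_neutral_left)
      show "\<forall>e\<in>E - S. \<gamma> e * (x - z) $ e = 0"
        unfolding \<gamma>_def using C w by (metis Diff_iff diff_self mult_zero_left)
    qed (use \<open>S \<subseteq> E\<close> in auto)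
    ultimately have "h \<bullet> (x - z) + (\<Sum>e\<in>S. \<gamma> e * (x - z) $ e)
        = (\<Sum>e\<in>E. h $ w (C e) * (x - z) $ e)"
      by (simp add: \<gamma>_def left_diff_distrib flip: sum.distrib)
    also have "\<dots> = (\<Sum>U\<in>P. \<Sum>e\<in>U. h $ w (C e) * (x - z) $ e)"
      by (simp add: sum_components[OF part])
    also have "\<dots> = (\<Sum>U\<in>P. h $ w U * (\<Sum>e\<in>U. (x - z) $ e))"
      unfolding sum_distrib_left using C_eq by (intro sum.cong) auto
    also have "\<dots> = 0"
      using x z base_polyhedron_component_sum[OF comp]
      by (intro sum.neutral) (simp add: X_def sum_subtractf)
    finally show ?thesis .
  qed
  \<comment> \<open>The subgradient inequality at \<open>z\<close>, with its linear term rewritten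
    by \<open>key\<close> as a difference of \<gamma> sums.\<close>
  have "c z + (\<Sum>e\<in>S. \<gamma> e * z $ e) \<le> c x + (\<Sum>e\<in>S. \<gamma> e * x $ e)" if x: "x \<in> X" for x
    using key[OF x] h[of x] V(2) V(4)[OF x] V(4)[OF z] x
    by (auto simp: right_diff_distrib sum_subtractf)
  then show "\<exists>\<gamma>. is_arg_min (\<lambda>x. c x + (\<Sum>e\<in>S. \<gamma> e * x $ e)) (\<lambda>x. x \<in> X) z"
    using z by (auto simp: is_arg_min_linorder)
qed

theorem theorem5p1:
  fixes E S :: "'e::finite set" and f :: "'e set \<Rightarrow> real"
    and X :: "(real ^ 'e) set" and P :: "'e set set"
  assumes "polymatroid E f"
    and "X = base_polyhedron E f"
    and "polymatroid_components E f P"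
    and "S \<subseteq> E"
  shows "(controlling S X (convex_costs X) \<longleftrightarrow> identifying S X) \<and>
         (identifying S X \<longleftrightarrow> (\<forall>U\<in>P. card (S \<inter> U) \<ge> card U - 1))"
  using controlling_imp_identifying[OF convex_base_polyhedron, of S E f]
    identifying_imp_card[OF assms(1,3), of S] card_imp_controlling[OF assms(3,4)]
  unfolding assms(2) by blast

end
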